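(* For every integer $k>3$, there does not exist a local $k$-star-mesh transform that preserves $d_\infty$.
   Context: For a graph $G=(V,E,w)$ with positive edge weights, $d_{\infty,G}(s,t)=\min\{\max_{e\in E}|f(e)/w(e)|: f \text{ a flow shipping one unit from } s \text{ to } t\}$, which equals $1/\mathrm{mincut}(s,t)$ (weights allowed to be $+\infty$ as well). A $k$-star-mesh transform is an operation that, given a graph $G$ and a vertex $r\in V(G)$ of degree $k$, removes $r$ from $G$ and replaces the $k$-star formed by $r$ and its neighbors with a (possibly weighted) clique on $N(r)$. It is local if the clique edge weights depend only on the weights of the $k$ star edges of $r$ (obliviously to the rest of $G$). A local $k$-star-mesh transform preserves $d_\infty$ if for every graph $G$ and every vertex $r$ of degree $k$, the transformed graph $G'$ satisfies $d_{\infty,G'}(s,t)=d_{\infty,G}(s,t)$ for all $s,t\in V\setminus\{r\}$. *)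

theory Defs
  imports "HOL-Library.Extended_Nonnegative_Real" "HOL-Library.Infinite_Typeclass"
begin

text \<open>
  Edges are two-element vertex sets; \<^typ>\<open>ennreal\<close> allows the weight \<open>\<infinity>\<close>.
  The value of \<open>weight\<close> outside \<open>edges\<close> is irrelevant.
\<close>

record 'v wgraph =
  verts :: "'v set"
  edges :: "'v set set"
  weight :: "'v set \<Rightarrow> ennreal"

definition two_subsets :: "'v set \<Rightarrow> 'v set set" where
  "two_subsets A = {e. e \<subseteq> A \<and> card e = 2}"

definition is_wgraph :: "'v wgraph \<Rightarrow> bool" where
  "is_wgraph G \<longleftrightarrow>
     finite (verts G) \<and> edges G \<subseteq> two_subsets (verts G) \<and> (\<forall>e\<in>edges G. weight G e > 0)"

definition nbrs :: "'v wgraph \<Rightarrow> 'v \<Rightarrow> 'v set" where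
  "nbrs G r = {v. {r, v} \<in> edges G}"

definition degree :: "'v wgraph \<Rightarrow> 'v \<Rightarrow> nat" where
  "degree G r = card {e \<in> edges G. r \<in> e}"

text \<open>
  A flow is antisymmetric: \<open>f u v\<close> is the signed amount sent from \<open>u\<close> to \<open>v\<close> along the edge
  \<open>{u, v}\<close>, so no orientation of the edges has to be fixed. For \<open>s = t\<close> the demand is zero.
\<close>

definition unit_flow :: "'v wgraph \<Rightarrow> 'v \<Rightarrow> 'v \<Rightarrow> ('v \<Rightarrow> 'v \<Rightarrow> real) \<Rightarrow> bool" where
  "unit_flow G s t f \<longleftrightarrow>
     (\<forall>u v. f u v = - f v u) \<and>
     (\<forall>u v. {u, v} \<notin> edges G \<longrightarrow> f u v = 0) \<and>
     (\<forall>u\<in>verts G. (\<Sum>v\<in>verts G. f u v) = of_bool (u = s) - of_bool (u = t))"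

text \<open>
  The maximum is written as a supremum, so that it is \<open>0\<close> for an edgeless graph. In
  \<^typ>\<open>ennreal\<close> a finite number divided by \<open>\<infinity>\<close> is \<open>0\<close>.
\<close>

definition congestion :: "'v wgraph \<Rightarrow> ('v \<Rightarrow> 'v \<Rightarrow> real) \<Rightarrow> ennreal" where
  "congestion G f = (SUP (u, v) \<in> {(u, v). {u, v} \<in> edges G}. ennreal \<bar>f u v\<bar> / weight G {u, v})"

text \<open>
  The infimum is \<open>\<infinity>\<close> if there is no flow, that is, if \<open>s\<close> and \<open>t\<close> are disconnected.
\<close>

definition d_inf :: "'v wgraph \<Rightarrow> 'v \<Rightarrow> 'v \<Rightarrow> ennreal" where
  "d_inf G s t = (INF f \<in> {f. unit_flow G s t f}. congestion G f)"

text \<open>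
  Replacing the star of \<open>r\<close> by a clique on its neighbours with edge weights \<open>c\<close>.
  A clique edge of weight \<open>0\<close> is an absent edge. A clique edge that is parallel to an edge
  already present is merged with it by adding the weights; this does not affect
  \<^const>\<open>d_inf\<close>, as a flow through two parallel edges is best split proportionally to the weights.
\<close>

definition star_mesh :: "'v wgraph \<Rightarrow> 'v \<Rightarrow> ('v set \<Rightarrow> ennreal) \<Rightarrow> 'v wgraph" where
  "star_mesh G r c =
     \<lparr>verts = verts G - {r},
      edges = {e \<in> edges G. r \<notin> e} \<union> {e \<in> two_subsets (nbrs G r). c e > 0},
      weight = (\<lambda>e. (if e \<in> edges G then weight G e else 0) +
                    (if e \<in> two_subsets (nbrs G r) then c e else 0))\<rparr>"

text \<open>
  A \<open>k\<close>-star-mesh transform is given by the clique weights \<open>T G r e\<close> it assigns, for a graph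
  \<open>G\<close>, a vertex \<open>r\<close> of degree \<open>k\<close> and a pair \<open>e\<close> of neighbours of \<open>r\<close>; values of \<open>T\<close> at
  other arguments are irrelevant.
\<close>

type_synonym 'v mesh_transform = "'v wgraph \<Rightarrow> 'v \<Rightarrow> 'v set \<Rightarrow> ennreal"

text \<open>
  The weights of the star edges are read as a family indexed by the star edges, so no
  symmetry of \<open>T\<close> under renaming of vertices is required.
\<close>

definition local_transform :: "nat \<Rightarrow> 'v mesh_transform \<Rightarrow> bool" where
  "local_transform k T \<longleftrightarrow>
     (\<forall>G H r. is_wgraph G \<and> is_wgraph H \<and> r \<in> verts G \<and> r \<in> verts H \<and>
        degree G r = k \<and> degree H r = k \<and>
        nbrs G r = nbrs H r \<and> (\<forall>v\<in>nbrs G r. weight G {r, v} = weight H {r, v}) \<longrightarrow>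
        (\<forall>e\<in>two_subsets (nbrs G r). T G r e = T H r e))"

definition preserves_d_inf :: "nat \<Rightarrow> 'v mesh_transform \<Rightarrow> bool" where
  "preserves_d_inf k T \<longleftrightarrow>
     (\<forall>G r. is_wgraph G \<and> r \<in> verts G \<and> degree G r = k \<longrightarrow>
        (\<forall>s\<in>verts G - {r}. \<forall>t\<in>verts G - {r}.
           d_inf (star_mesh G r (T G r)) s t = d_inf G s t))"

end

theory Submission
  imports Defs
begin

text \<open>
  Give all \<open>k\<close> star edges weight 1 and join the leaves within \<open>A\<close>, and within its complement, by
  edges of weight \<open>\<infinity>\<close>. By locality all these graphs receive the same clique weights \<open>c\<close>, and
  preservation of \<^const>\<open>d_inf\<close> forces the weight \<open>C A\<close> of the clique edges leaving \<open>A\<close> to equal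
  \<open>min (card A) (k - card A)\<close>. Hence \<open>C {a} \<le> 1\<close>, while \<open>C {a, b} \<ge> 2\<close> because \<open>k > 3\<close>. From
  \<open>C {a} + C {b} = C {a, b} + 2 * c {a, b}\<close> all clique weights vanish, contradicting
  \<open>C {a, b} \<ge> 2\<close>.
\<close>

section \<open>Elementary facts on vertex pairs, \<open>ennreal\<close> and congestion\<close>

lemma pair_in_two_subsets: "{u, v} \<in> two_subsets A \<longleftrightarrow> u \<in> A \<and> v \<in> A \<and> u \<noteq> v"
  by (auto simp: two_subsets_def card_insert_if)

text \<open>Distances are compared through reciprocals of cut weights; this turns such comparisons
  into bounds on the clique weights. The extreme values cause no exception because
  \<open>inverse\<close> exchanges 0 and \<infinity>.\<close>

lemma inverse_le_imp_le_ennreal: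
  fixes a b :: ennreal
  assumes "inverse a \<le> inverse b"
  shows "b \<le> a"
  using assms
  by (cases "a = 0"; cases "b = 0"; cases a rule: ennreal_cases; cases b rule: ennreal_cases)
    (auto simp: inverse_ennreal top_unique)

lemma congestion_leI:
  assumes "\<And>u v. {u, v} \<in> edges G \<Longrightarrow> ennreal \<bar>f u v\<bar> / weight G {u, v} \<le> q"
  shows "congestion G f \<le> q"
  unfolding congestion_def using assms by (auto intro!: SUP_least)

lemma congestion_ge:
  assumes "{u, v} \<in> edges G"
  shows "ennreal \<bar>f u v\<bar> / weight G {u, v} \<le> congestion G f"
  unfolding congestion_def using assms by (auto intro!: SUP_upper2[of "(u, v)"])

lemma d_inf_le:
  assumes "unit_flow G s t f"
    and "\<And>u v. {u, v} \<in> edges G \<Longrightarrow> ennreal \<bar>f u v\<bar> / weight G {u, v} \<le> q"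
  shows "d_inf G s t \<le> q"
  unfolding d_inf_def using assms by (auto intro!: INF_lower2[of f] congestion_leI)

section \<open>Bounding \<open>d_inf\<close>: cuts from below, explicit flows from above\<close>

lemma flow_across_cut:
  assumes "unit_flow G s t f" "finite (verts G)" "S \<subseteq> verts G" "s \<in> S" "t \<notin> S"
  shows "(\<Sum>u\<in>S. \<Sum>v\<in>verts G - S. f u v) = 1"
proof -
  have fin: "finite S" using assms finite_subset by blast
  have anti: "f u v = - f v u" for u v
    using assms(1) unfolding unit_flow_def by blast
  \<comment> \<open>Antisymmetry cancels the flow between vertices of \<open>S\<close>. Hence the
    net outflow of \<open>S\<close>, which is 1 by conservation summed over \<open>S\<close>, goes
    entirely to the complement.\<close>
  have "(\<Sum>u\<in>S. \<Sum>v\<in>S. f u v) = (\<Sum>u\<in>S. \<Sum>v\<in>S. - f v u)"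
    by (intro sum.cong refl) (rule anti)
  also have "\<dots> = - (\<Sum>u\<in>S. \<Sum>v\<in>S. f u v)"
    by (subst sum.swap) (simp add: sum_negf)
  finally have inner: "(\<Sum>u\<in>S. \<Sum>v\<in>S. f u v) = 0" by simp
  have "(\<Sum>u\<in>S. \<Sum>v\<in>verts G. f u v) = (\<Sum>u\<in>S. of_bool (u = s) - of_bool (u = t))"
    using assms unfolding unit_flow_def by (intro sum.cong refl) blast
  also have "\<dots> = (\<Sum>u\<in>S. if u = s then 1 else 0)"
    using assms by (intro sum.cong) auto
  also have "\<dots> = 1" using fin assms by simp
  finally have "(\<Sum>u\<in>S. \<Sum>v\<in>verts G. f u v) = 1" .
  moreover have "(\<Sum>v\<in>verts G. f u v) = (\<Sum>v\<in>verts G - S. f u v) + (\<Sum>v\<in>S. f u v)" for u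
    by (rule sum.subset_diff) (use assms in auto)
  ultimately show ?thesis using inner by (simp add: sum.distrib)
qed

text \<open>The easy half of max-flow min-cut: a whole unit crosses the cut, and each crossing edge
  carries at most the congestion times its weight. A cut of infinite weight gives only the trivial
  bound 0.\<close>

lemma d_inf_ge_inverse_cut:
  assumes G: "is_wgraph G" and S: "S \<subseteq> verts G" "s \<in> S" "t \<notin> S"
  shows "inverse (\<Sum>u\<in>S. \<Sum>v\<in>verts G - S. if {u, v} \<in> edges G then weight G {u, v} else 0)
    \<le> d_inf G s t"
    (is "inverse ?C \<le> _")
proof (cases "?C = \<infinity>")
  case False
  have fin: "finite (verts G)" "finite S"
    using G S finite_subset by (auto simp: is_wgraph_def)
  have "inverse ?C \<le> congestion G f" if f: "unit_flow G s t f" for f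
  proof -
    let ?q = "congestion G f"
    have edge: "ennreal \<bar>f u v\<bar> \<le> ?q * (if {u, v} \<in> edges G then weight G {u, v} else 0)"
      if uv: "u \<in> S" "v \<in> verts G - S" for u v
    proof (cases "{u, v} \<in> edges G")
      case True
      have "weight G {u, v} \<noteq> 0" using G True by (auto simp: is_wgraph_def)
      \<comment> \<open>Dividing by a weight and multiplying back is the identity only for finite
        nonzero weights. An infinite crossing edge would make the whole cut infinite.\<close>
      moreover have "weight G {u, v} \<noteq> \<infinity>"
      proof
        assume "weight G {u, v} = \<infinity>"
        then have "(\<Sum>v\<in>verts G - S. if {u, v} \<in> edges G then weight G {u, v} else 0) = \<infinity>"
          using fin uv True by auto
        then show False using False fin uv by auto
      qed
      ultimately have "ennreal \<bar>f u v\<bar> = ennreal \<bar>f u v\<bar> / weight G {u, v} * weight G {u, v}"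
        by (simp add: ennreal_divide_times ennreal_times_divide less_top mult_divide_eq_ennreal)
      also have "\<dots> \<le> ?q * weight G {u, v}"
        by (intro mult_right_mono congestion_ge True) simp
      finally show ?thesis using True by simp
    next
      case False
      then have "f u v = 0" using f unfolding unit_flow_def by blast
      then show ?thesis by simp
    qed
    have "(1::ennreal) = ennreal (\<Sum>u\<in>S. \<Sum>v\<in>verts G - S. f u v)"
      using flow_across_cut[OF f fin(1) S] by simp
    also have "\<dots> \<le> ennreal (\<Sum>u\<in>S. \<Sum>v\<in>verts G - S. \<bar>f u v\<bar>)"
      by (intro ennreal_leI sum_mono) auto
    also have "\<dots> = (\<Sum>u\<in>S. \<Sum>v\<in>verts G - S. ennreal \<bar>f u v\<bar>)"
      by (simp add: sum_nonneg flip: sum_ennreal)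
    also have "\<dots> \<le> ?q * ?C"
      unfolding sum_distrib_left by (intro sum_mono edge)
    finally have le: "1 \<le> ?q * ?C" .
    \<comment> \<open>In \<open>ennreal\<close> even \<infinity> times 0 is 0, so this holds for
      infinite congestion too.\<close>
    then have "?C \<noteq> 0" by auto
    then have "inverse ?C * ?C = 1"
      using ennreal_divide_self[of ?C] False
      by (simp add: divide_ennreal_def mult.commute less_top del: ennreal_sum_eq_top)
    have "inverse ?C \<le> (?q * ?C) * inverse ?C"
      using mult_right_mono[OF le, of "inverse ?C"] by simp
    also have "\<dots> = ?q" using \<open>inverse ?C * ?C = 1\<close> by (simp add: ac_simps)
    finally show ?thesis .
  qed
  then show ?thesis unfolding d_inf_def by (auto intro: INF_greatest)
qed simp

text \<open>Sharing out one unit in proportion to \<open>c\<close> gives every ratio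
  \<open>p v / c v\<close> the same value \<open>inverse (sum c B)\<close>. If the total is
  infinite, some \<open>c b\<close> is infinite and takes the whole unit at ratio 0.\<close>

lemma proportional_split:
  fixes c :: "'a \<Rightarrow> ennreal"
  assumes fin: "finite B" and pos: "sum c B \<noteq> 0"
  obtains p :: "'a \<Rightarrow> real"
  where "\<And>v. 0 \<le> p v" "sum p B = 1" "\<And>v. v \<in> B \<Longrightarrow> c v = 0 \<Longrightarrow> p v = 0"
    "\<And>v. v \<in> B \<Longrightarrow> c v \<noteq> 0 \<Longrightarrow> ennreal (p v) / c v \<le> inverse (sum c B)"
proof (cases "sum c B = \<infinity>")
  case True
  then obtain b where b: "b \<in> B" "c b = \<infinity>" using fin by auto
  show ?thesis
    by (rule that[of "\<lambda>v. if v = b then 1 else 0"]) (use b fin in auto)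
next
  case False
  let ?C = "enn2real (sum c B)"
  have C: "sum c B = ennreal ?C" "?C > 0"
    using False pos by (auto simp: enn2real_positive_iff less_top zero_less_iff_neq_zero)
  have cv: "c v = ennreal (enn2real (c v))" if "v \<in> B" for v
    using False fin that by (auto simp: less_top)
  have "sum c B = (\<Sum>v\<in>B. ennreal (enn2real (c v)))"
    using cv by (intro sum.cong) auto
  also have "\<dots> = ennreal (\<Sum>v\<in>B. enn2real (c v))" by (intro sum_ennreal) simp
  finally have sum: "?C = (\<Sum>v\<in>B. enn2real (c v))" by (simp add: sum_nonneg)
  show ?thesis
  proof (rule that[of "\<lambda>v. enn2real (c v) / ?C"])
    show "(\<Sum>v\<in>B. enn2real (c v) / ?C) = 1"
      using C(2) sum by (simp flip: sum_divide_distrib)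
    fix v assume v: "v \<in> B" "c v \<noteq> 0"
    then have "enn2real (c v) > 0" using cv[OF v(1)] by (metis ennreal_0 enn2real_nonneg less_eq_real_def)
    then have "ennreal (enn2real (c v) / ?C) / ennreal (enn2real (c v)) = inverse (ennreal ?C)"
      using C(2) by (simp add: divide_ennreal inverse_ennreal field_simps)
    then show "ennreal (enn2real (c v) / ?C) / c v \<le> inverse (sum c B)"
      using cv[OF v(1)] C(1) by simp
  qed (use C in auto)
qed

text \<open>As a difference of indicators this is antisymmetric by form, and it becomes the zero
  flow when \<open>a = b\<close>, so degenerate paths need no separate treatment.\<close>

definition arc_flow :: "'v \<Rightarrow> 'v \<Rightarrow> 'v \<Rightarrow> 'v \<Rightarrow> real" where
  "arc_flow a b u v = of_bool (u = a \<and> v = b) - of_bool (u = b \<and> v = a)"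

lemma arc_flow_antisym: "arc_flow a b u v = - arc_flow a b v u"
  by (simp only: arc_flow_def conj_commute minus_diff_eq)

lemma arc_flow_eq_0:
  assumes "{u, v} \<noteq> {a, b} \<or> u = v"
  shows "arc_flow a b u v = 0"
proof (cases "u = v")
  case True
  then show ?thesis using arc_flow_antisym[of a b u u] by simp
next
  case False
  with assms have "\<not> (u = a \<and> v = b)" "\<not> (u = b \<and> v = a)" by blast+
  then show ?thesis by (simp only: arc_flow_def of_bool_eq(1) diff_self)
qed

lemma sum_arc_flow:
  assumes "finite V" "a \<in> V" "b \<in> V"
  shows "(\<Sum>v\<in>V. arc_flow a b u v) = of_bool (u = a) - of_bool (u = b)"
proof -
  have "(\<Sum>v\<in>V. of_bool (u = x \<and> v = y)) = (of_bool (u = x) :: real)" if "y \<in> V" for x y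
    using that assms(1) by (cases "u = x") (auto simp: of_bool_def)
  then show ?thesis using assms by (simp add: arc_flow_def sum_subtractf)
qed

section \<open>Stars with two rigid clusters of leaves, and their transforms\<close>

definition clustered_star :: "'v \<Rightarrow> 'v set \<Rightarrow> 'v set \<Rightarrow> 'v wgraph" where
  "clustered_star r N A =
     \<lparr>verts = insert r N,
      edges = (\<lambda>v. {r, v}) ` N \<union> two_subsets A \<union> two_subsets (N - A),
      weight = (\<lambda>e. if r \<in> e then 1 else \<infinity>)\<rparr>"

context
  fixes r :: 'v and N A :: "'v set"
  assumes fin: "finite N" and r: "r \<notin> N" and A: "A \<subseteq> N"
begin

lemma clustered_star_simps [simp]:
  "verts (clustered_star r N A) = insert r N"
  "weight (clustered_star r N A) e = (if r \<in> e then 1 else \<infinity>)"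
  by (auto simp: clustered_star_def)

lemma pair_in_clustered_star:
  "{u, v} \<in> edges (clustered_star r N A) \<longleftrightarrow>
     u = r \<and> v \<in> N \<or> v = r \<and> u \<in> N \<or> u \<in> N \<and> v \<in> N \<and> u \<noteq> v \<and> (u \<in> A \<longleftrightarrow> v \<in> A)"
  using A by (auto simp: clustered_star_def pair_in_two_subsets doubleton_eq_iff)

lemma is_wgraph_clustered_star: "is_wgraph (clustered_star r N A)"
  using fin r A by (auto simp: is_wgraph_def clustered_star_def two_subsets_def card_insert_if)

lemma nbrs_clustered_star: "nbrs (clustered_star r N A) r = N"
  using r by (auto simp: nbrs_def pair_in_clustered_star)

lemma degree_clustered_star: "degree (clustered_star r N A) r = card N"
proof -
  have "{e \<in> edges (clustered_star r N A). r \<in> e} = (\<lambda>v. {r, v}) ` N"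
    using r A by (auto simp: clustered_star_def two_subsets_def)
  moreover have "inj_on (\<lambda>v. {r, v}) N" by (auto simp: inj_on_def doubleton_eq_iff)
  ultimately show ?thesis by (simp add: degree_def card_image)
qed

lemma verts_star_mesh_clustered_star:
  "verts (star_mesh (clustered_star r N A) r c) = N"
  using r by (auto simp: star_mesh_def)

lemma pair_in_star_mesh_clustered_star:
  "{u, v} \<in> edges (star_mesh (clustered_star r N A) r c) \<longleftrightarrow>
     u \<in> N \<and> v \<in> N \<and> u \<noteq> v \<and> ((u \<in> A \<longleftrightarrow> v \<in> A) \<or> c {u, v} > 0)"
  using r by (auto simp: star_mesh_def nbrs_clustered_star pair_in_clustered_star pair_in_two_subsets)

text \<open>Inside a cluster the original weight \<infinity> absorbs the added clique weight, so
  \<open>c\<close> is visible only between the clusters.\<close>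

lemma weight_star_mesh_clustered_star:
  assumes "u \<in> N" "v \<in> N" "u \<noteq> v"
  shows "weight (star_mesh (clustered_star r N A) r c) {u, v} =
    (if u \<in> A \<longleftrightarrow> v \<in> A then \<infinity> else c {u, v})"
  using assms r
  by (auto simp: star_mesh_def nbrs_clustered_star pair_in_clustered_star pair_in_two_subsets)

lemma is_wgraph_star_mesh_clustered_star: "is_wgraph (star_mesh (clustered_star r N A) r c)"
proof -
  let ?H = "star_mesh (clustered_star r N A) r c"
  have sub: "edges ?H \<subseteq> two_subsets N"
    using r A unfolding star_mesh_def nbrs_clustered_star
    by (auto simp: clustered_star_def two_subsets_def)
  moreover have "weight ?H e > 0" if e: "e \<in> edges ?H" for e
  proof -
    have "e \<subseteq> N" "card e = 2" using e sub by (auto simp: two_subsets_def)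
    then obtain u v where "e = {u, v}" "u \<noteq> v" "u \<in> N" "v \<in> N"
      by (auto simp: card_2_iff)
    then show ?thesis
      using e by (auto simp: weight_star_mesh_clustered_star pair_in_star_mesh_clustered_star)
  qed
  ultimately show ?thesis
    using fin by (simp add: is_wgraph_def verts_star_mesh_clustered_star)
qed

text \<open>Only clique edges join \<open>A\<close> to the rest of \<open>N\<close> once
  \<open>r\<close> is gone. Absent ones have \<open>c\<close> equal to 0, so the cut weight is the
  plain sum of \<open>c\<close>.\<close>

lemma d_inf_star_mesh_ge_inverse_cut:
  assumes "s \<in> A" "t \<notin> A"
  shows "inverse (\<Sum>u\<in>A. \<Sum>v\<in>N - A. c {u, v})
    \<le> d_inf (star_mesh (clustered_star r N A) r c) s t"
proof -
  let ?H = "star_mesh (clustered_star r N A) r c"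
  have "(\<Sum>u\<in>A. \<Sum>v\<in>N - A. if {u, v} \<in> edges ?H then weight ?H {u, v} else 0)
      = (\<Sum>u\<in>A. \<Sum>v\<in>N - A. c {u, v})"
    using A by (intro sum.cong refl)
      (auto simp: pair_in_star_mesh_clustered_star weight_star_mesh_clustered_star)
  then show ?thesis
    using d_inf_ge_inverse_cut[of ?H A s t] assms A
    by (simp add: verts_star_mesh_clustered_star is_wgraph_star_mesh_clustered_star)
qed

end

section \<open>Distance estimates for clusters of one and of two leaves\<close>

lemma d_inf_isolated_leaf_ge:
  assumes "finite N" "r \<notin> N" "a \<in> N" "t \<noteq> a"
  shows "1 \<le> d_inf (clustered_star r N {a}) a t"
proof -
  let ?G = "clustered_star r N {a}"
  have A: "{a} \<subseteq> N" using assms by simp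
  note simps = clustered_star_simps[OF assms(1,2) A] pair_in_clustered_star[OF assms(1,2) A]
  \<comment> \<open>The cluster \<open>{a}\<close> has no inner edges, so the star edge to
    \<open>r\<close>, of weight 1, is the only edge at \<open>a\<close>.\<close>
  have "(\<Sum>u\<in>{a}. \<Sum>v\<in>verts ?G - {a}. if {u, v} \<in> edges ?G then weight ?G {u, v} else 0)
      = (\<Sum>v\<in>insert r N - {a}. if v = r then 1 else 0)"
    using assms by (auto simp: simps intro!: sum.cong)
  also have "\<dots> = (1 :: ennreal)" using assms by auto
  finally show ?thesis
    using d_inf_ge_inverse_cut[of ?G "{a}" a t] is_wgraph_clustered_star[OF assms(1,2) A] assms
    by (simp add: simps)
qed

text \<open>The unit leaves \<open>a\<close> split in proportion to the clique weights. It is then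
  collected at \<open>t\<close> over edges of weight \<infinity> at no cost, so the edges at
  \<open>a\<close> are the only bottleneck.\<close>

lemma d_inf_star_mesh_isolated_leaf_le:
  assumes "finite N" "r \<notin> N" "a \<in> N" "t \<in> N" "t \<noteq> a"
    and pos: "(\<Sum>v\<in>N - {a}. c {a, v}) \<noteq> 0"
  shows "d_inf (star_mesh (clustered_star r N {a}) r c) a t \<le> inverse (\<Sum>v\<in>N - {a}. c {a, v})"
proof -
  let ?B = "N - {a}" and ?H = "star_mesh (clustered_star r N {a}) r c"
  have A: "{a} \<subseteq> N" using assms by simp
  have finB: "finite ?B" using assms by simp
  note pair = pair_in_star_mesh_clustered_star[OF assms(1,2) A, of _ _ c]
    and wt = weight_star_mesh_clustered_star[OF assms(1,2) A, of _ _ c]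
    and V = verts_star_mesh_clustered_star[OF assms(1,2) A, of c]
  obtain p :: "'a \<Rightarrow> real" where p: "\<And>v. 0 \<le> p v" "sum p ?B = 1"
      "\<And>v. v \<in> ?B \<Longrightarrow> c {a, v} = 0 \<Longrightarrow> p v = 0"
      "\<And>v. v \<in> ?B \<Longrightarrow> c {a, v} \<noteq> 0 \<Longrightarrow> ennreal (p v) / c {a, v} \<le> inverse (\<Sum>v\<in>?B. c {a, v})"
    using proportional_split[OF finB pos] by blast
  \<comment> \<open>The share \<open>p b\<close> follows the path \<open>a\<close>,
    \<open>b\<close>, \<open>t\<close>; for \<open>b = t\<close> the second leg is the zero
    flow.\<close>
  define f where "f u v = (\<Sum>b\<in>?B. p b * (arc_flow a b u v + arc_flow b t u v))" for u v
  have anti: "f u v = - f v u" for u v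
  proof -
    have "f u v = (\<Sum>b\<in>?B. - (p b * (arc_flow a b v u + arc_flow b t v u)))"
      unfolding f_def
      by (intro sum.cong refl) (simp add: arc_flow_antisym[of _ _ u v] algebra_simps)
    then show ?thesis by (simp add: f_def sum_negf)
  qed
  \<comment> \<open>Second legs avoid \<open>a\<close>, since \<open>b\<close> and \<open>t\<close>
    differ from it, so only the first leg towards \<open>v\<close> contributes.\<close>
  have fa: "f a v = p v" if "v \<in> ?B" for v
  proof -
    have "f a v = (\<Sum>b\<in>?B. if b = v then p v else 0)"
      unfolding f_def using assms that by (intro sum.cong refl) (auto simp: arc_flow_def)
    then show ?thesis using that finB by simp
  qed
  have outside: "f u v = 0" if "\<not> (u \<in> N \<and> v \<in> N \<and> u \<noteq> v)" for u v
  proof -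
    have "arc_flow x y u v = 0" if "x \<in> N" "y \<in> N" for x y
      by (rule arc_flow_eq_0) (use that \<open>\<not> (u \<in> N \<and> v \<in> N \<and> u \<noteq> v)\<close> in auto)
    then show ?thesis
      unfolding f_def using assms by (intro sum.neutral ballI) simp
  qed
  have "unit_flow ?H a t f"
    unfolding unit_flow_def
  proof (intro conjI allI impI ballI)
    fix u v show "f u v = - f v u" by (fact anti)
  next
    fix u v assume nonedge: "{u, v} \<notin> edges ?H"
    show "f u v = 0"
    proof (cases "u \<in> N \<and> v \<in> N \<and> u \<noteq> v")
      case True
      \<comment> \<open>All pairs inside \<open>?B\<close> are edges, so a missing pair joins
        \<open>a\<close> to a leaf with clique weight 0, and such a leaf gets share 0.\<close>
      then consider "u = a" "v \<in> ?B" "c {a, v} = 0" | "v = a" "u \<in> ?B" "c {a, u} = 0"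
        using nonedge by (auto simp: pair insert_commute)
      then show ?thesis
      proof cases
        case 1 then show ?thesis using fa p(3) by auto
      next
        case 2 then show ?thesis using fa p(3) anti[of u v] by auto
      qed
    qed (rule outside)
  next
    fix u assume "u \<in> verts ?H"
    have "(\<Sum>v\<in>N. f u v) =
        (\<Sum>b\<in>?B. p b * ((\<Sum>v\<in>N. arc_flow a b u v) + (\<Sum>v\<in>N. arc_flow b t u v)))"
      unfolding f_def by (subst sum.swap) (simp add: sum.distrib flip: sum_distrib_left)
    \<comment> \<open>Inflow and outflow at the intermediate vertex \<open>b\<close> cancel.\<close>
    also have "\<dots> = (\<Sum>b\<in>?B. p b * (of_bool (u = a) - of_bool (u = t)))"
      using assms by (intro sum.cong refl) (simp add: sum_arc_flow)
    also have "\<dots> = of_bool (u = a) - of_bool (u = t)"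
      using p(2) by (simp flip: sum_distrib_right)
    finally show "(\<Sum>v\<in>verts ?H. f u v) = of_bool (u = a) - of_bool (u = t)" by (simp add: V)
  qed
  then show ?thesis
  proof (rule d_inf_le)
    have at_a: "ennreal \<bar>f a v\<bar> / weight ?H {a, v} \<le> inverse (\<Sum>v\<in>?B. c {a, v})"
      if "{a, v} \<in> edges ?H" for v
      using that p(1) p(4)[of v] fa[of v] by (auto simp: pair wt)
    fix u v assume e: "{u, v} \<in> edges ?H"
    consider "u = a" | "v = a" | "u \<noteq> a" "v \<noteq> a" by blast
    then show "ennreal \<bar>f u v\<bar> / weight ?H {u, v} \<le> inverse (\<Sum>v\<in>?B. c {a, v})"
    proof cases
      case 1 then show ?thesis using at_a e by simp
    next
      case 2 then show ?thesis
        using at_a[of u] e anti[of u v] by (simp add: insert_commute)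
    next
      case 3 then show ?thesis using e by (simp add: pair wt)
    qed
  qed
qed

text \<open>Half a unit takes the path \<open>a\<close>, \<open>r\<close>, \<open>x\<close> and the
  other half the path \<open>a\<close>, \<open>b\<close>, \<open>r\<close>, \<open>y\<close>,
  \<open>x\<close>. The edges \<open>{a, b}\<close> and \<open>{y, x}\<close> have weight
  \<infinity>, so congestion arises only on four star edges, each carrying one half.\<close>

lemma d_inf_leaf_pair_le:
  assumes "finite N" "r \<notin> N" "a \<in> N" "b \<in> N" "x \<in> N" "y \<in> N" "distinct [a, b, x, y]"
  shows "d_inf (clustered_star r N {a, b}) a x \<le> inverse 2"
proof -
  let ?G = "clustered_star r N {a, b}"
  have A: "{a, b} \<subseteq> N" using assms by simp
  note simps = clustered_star_simps[OF assms(1,2) A] pair_in_clustered_star[OF assms(1,2) A]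
  define f where "f u v = (arc_flow a r u v + arc_flow a b u v + arc_flow b r u v +
    arc_flow r x u v + arc_flow r y u v + arc_flow y x u v) / 2" for u v
  have ne: "r \<noteq> a" "r \<noteq> b" "r \<noteq> x" "r \<noteq> y" using assms by auto
  have anti: "f u v = - f v u" for u v
    unfolding f_def arc_flow_antisym[of _ _ u v] by (simp add: field_simps)
  have at_r: "\<bar>f r v\<bar> \<le> 1 / 2" for v
    using ne assms(7)
    by (cases "v = a"; cases "v = b"; cases "v = x"; cases "v = y") (simp_all add: f_def arc_flow_def)
  have "unit_flow ?G a x f"
    unfolding unit_flow_def
  proof (intro conjI allI impI ballI)
    fix u v show "f u v = - f v u" by (fact anti)
  next
    fix u v assume "{u, v} \<notin> edges ?G"
    then have zero: "arc_flow p q u v = 0" if "{p, q} \<in> edges ?G" for p q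
      using that by (intro arc_flow_eq_0) auto
    have "{a, r} \<in> edges ?G" "{a, b} \<in> edges ?G" "{b, r} \<in> edges ?G"
      "{r, x} \<in> edges ?G" "{r, y} \<in> edges ?G" "{y, x} \<in> edges ?G"
      unfolding simps using assms by auto
    then show "f u v = 0" by (simp add: f_def zero)
  next
    fix u
    show "(\<Sum>v\<in>verts ?G. f u v) = of_bool (u = a) - of_bool (u = x)"
      unfolding f_def simps
      using assms by (simp add: sum.distrib sum_arc_flow flip: sum_divide_distrib del: sum.insert)
  qed
  then show ?thesis
  proof (rule d_inf_le)
    fix u v assume "{u, v} \<in> edges ?G"
    moreover have "ennreal \<bar>f u v\<bar> \<le> inverse 2" if "r \<in> {u, v}"
      unfolding ennreal_half[symmetric]
      by (rule ennreal_leI) (use that at_r[of u] at_r[of v] anti[of u r] in auto)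
    ultimately show "ennreal \<bar>f u v\<bar> / weight ?G {u, v} \<le> inverse 2"
      by (auto simp: simps divide_ennreal_def)
  qed
qed

section \<open>Combining the estimates by locality\<close>

theorem theorem3p24:
  fixes k :: nat
  assumes "k > 3"
  shows "\<not> (\<exists>T :: ('v::infinite) mesh_transform. local_transform k T \<and> preserves_d_inf k T)"
proof
  assume "\<exists>T :: 'v mesh_transform. local_transform k T \<and> preserves_d_inf k T"
  then obtain T :: "'v mesh_transform" where loc: "local_transform k T" and pres: "preserves_d_inf k T"
    by blast
  obtain M :: "'v set" where M: "finite M" "card M = Suc k"
    using infinite_arbitrarily_large[OF infinite_UNIV] by blast
  then obtain r where "r \<in> M" by fastforce
  define N where "N = M - {r}"
  have N: "finite N" "card N = k" "r \<notin> N" using M \<open>r \<in> M\<close> by (auto simp: N_def)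
  let ?G = "clustered_star r N"
  have preserve: "d_inf (star_mesh (?G A) r (T (?G A) r)) s t = d_inf (?G A) s t"
    if "A \<subseteq> N" "s \<in> N" "t \<in> N" for A s t
    using pres that N is_wgraph_clustered_star[OF N(1,3) that(1)]
      degree_clustered_star[OF N(1,3) that(1)] clustered_star_simps[OF N(1,3) that(1)]
    unfolding preserves_d_inf_def by blast
  \<comment> \<open>The choice of the empty cluster is arbitrary: every \<open>?G A\<close> has the
    same neighbours of \<open>r\<close> and unit star weights, so locality yields the same clique
    weights.\<close>
  define c where "c = T (?G {}) r"
  have T_eq: "T (?G A) r {u, v} = c {u, v}" if "A \<subseteq> N" "u \<in> N" "v \<in> N" "u \<noteq> v" for A u v
  proof -
    have "\<forall>e\<in>two_subsets (nbrs (?G A) r). T (?G A) r e = T (?G {}) r e"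
      using loc unfolding local_transform_def
      by (rule allE[where x = "?G A"], elim allE[where x = "?G {}"] allE[where x = r])
        (use N that in \<open>simp add: is_wgraph_clustered_star degree_clustered_star
          nbrs_clustered_star clustered_star_simps\<close>)
    then show ?thesis
      using that N by (simp add: c_def nbrs_clustered_star pair_in_two_subsets)
  qed
  have single: "(\<Sum>v\<in>N - {a}. c {a, v}) \<le> 1" if a: "a \<in> N" for a
  proof (cases "(\<Sum>v\<in>N - {a}. c {a, v}) = 0")
    case False
    \<comment> \<open>A nonzero sum has a nonempty index set, which supplies a second leaf as the
      sink.\<close>
    then obtain t where t: "t \<in> N" "t \<noteq> a" by (metis Diff_iff singletonI sum.neutral)
    let ?c = "T (?G {a}) r"
    have eq: "(\<Sum>v\<in>N - {a}. ?c {a, v}) = (\<Sum>v\<in>N - {a}. c {a, v})"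
      using a by (intro sum.cong) (auto simp: T_eq)
    have "1 \<le> d_inf (?G {a}) a t" using d_inf_isolated_leaf_ge N a t by metis
    also have "\<dots> = d_inf (star_mesh (?G {a}) r ?c) a t" using preserve a t by simp
    also have "\<dots> \<le> inverse (\<Sum>v\<in>N - {a}. c {a, v})"
      using d_inf_star_mesh_isolated_leaf_le[of N r a t ?c] N a t False eq by simp
    finally have "inverse 1 \<le> inverse (\<Sum>v\<in>N - {a}. c {a, v})" by simp
    then show ?thesis by (rule inverse_le_imp_le_ennreal)
  qed simp
  have pair: "2 \<le> (\<Sum>u\<in>{a, b}. \<Sum>v\<in>N - {a, b}. c {u, v})" if ab: "a \<in> N" "b \<in> N" "a \<noteq> b" for a b
  proof -
    \<comment> \<open>This is where \<open>k > 3\<close> enters: two further leaves remain to serve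
      as \<open>x\<close> and \<open>y\<close>.\<close>
    have "2 \<le> card (N - {a, b})" using N ab assms by (simp add: card_Diff_subset)
    then obtain W where "W \<subseteq> N - {a, b}" "card W = 2" by (meson obtain_subset_with_card_n)
    then obtain x y where xy: "x \<in> N" "y \<in> N" "distinct [a, b, x, y]"
      using ab by (auto simp: card_2_iff)
    let ?c = "T (?G {a, b}) r"
    have eq: "(\<Sum>u\<in>{a, b}. \<Sum>v\<in>N - {a, b}. ?c {u, v}) = (\<Sum>u\<in>{a, b}. \<Sum>v\<in>N - {a, b}. c {u, v})"
      using ab by (intro sum.cong) (auto simp: T_eq)
    have "inverse (\<Sum>u\<in>{a, b}. \<Sum>v\<in>N - {a, b}. c {u, v}) \<le> d_inf (star_mesh (?G {a, b}) r ?c) a x"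
      using d_inf_star_mesh_ge_inverse_cut[of N r "{a, b}" a x ?c] N ab xy unfolding eq by auto
    also have "\<dots> = d_inf (?G {a, b}) a x" using preserve ab xy by simp
    also have "\<dots> \<le> inverse 2" using d_inf_leaf_pair_le N ab xy by metis
    finally show ?thesis by (rule inverse_le_imp_le_ennreal)
  qed
  have zero: "c {a, b} = 0" if ab: "a \<in> N" "b \<in> N" "a \<noteq> b" for a b
  proof -
    \<comment> \<open>\<open>P\<close> and \<open>Q\<close> are the contributions of
      \<open>a\<close> and \<open>b\<close> to the cut around \<open>{a, b}\<close>. The two
      single-leaf cuts together contain them and count \<open>c {a, b}\<close> twice.\<close>
    define P Q where "P = (\<Sum>v\<in>N - {a, b}. c {a, v})" and "Q = (\<Sum>v\<in>N - {a, b}. c {b, v})"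
    have split: "(\<Sum>v\<in>N - {p}. c {p, v}) = c {p, q} + (\<Sum>v\<in>N - {p, q}. c {p, v})"
      if "q \<in> N" "p \<noteq> q" for p q
      using sum.remove[of "N - {p}" q "\<lambda>v. c {p, v}"] that N(1) by (simp flip: Diff_insert2)
    have le: "c {a, b} + P \<le> 1" "c {a, b} + Q \<le> 1"
      using single[OF ab(1)] single[OF ab(2)] split[of b a] split[of a b] ab
      unfolding P_def Q_def insert_commute[of b a] by auto
    have PQ: "2 \<le> P + Q" using pair[OF ab] ab by (simp add: P_def Q_def)
    have "2 + (c {a, b} + c {a, b}) \<le> (P + Q) + (c {a, b} + c {a, b})"
      by (intro add_right_mono PQ)
    also have "\<dots> = (c {a, b} + P) + (c {a, b} + Q)" by (simp only: ac_simps)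
    also have "\<dots> \<le> 1 + 1" by (intro add_mono le)
    \<comment> \<open>The right side is written as \<open>2 + 0\<close> so that the finite summand 2
      can be cancelled in \<open>ennreal\<close>.\<close>
    finally have "2 + (c {a, b} + c {a, b}) \<le> 2 + 0" by simp
    then show ?thesis unfolding ennreal_add_left_cancel_le by simp
  qed
  have "2 \<le> card N" using N assms by simp
  then obtain W where "W \<subseteq> N" "card W = 2" by (meson obtain_subset_with_card_n)
  then obtain a b where ab: "a \<in> N" "b \<in> N" "a \<noteq> b" by (auto simp: card_2_iff)
  have "(\<Sum>u\<in>{a, b}. \<Sum>v\<in>N - {a, b}. c {u, v}) = 0"
    using ab by (intro sum.neutral ballI) (auto intro: zero)
  then show False using pair[OF ab] by (simp only:) simp
qed

end
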